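(* Let $(M,d)$ be a compact pointed metric space having a countable dense subset $P$ such that $B_{\mathrm{lip}_0(M)}$ is dense in $B_{\mathrm{Lip}_0(M)}$ for the topology of pointwise convergence on $P$. Then $\mathrm{lip}_0(M)^{**}\cong\mathrm{Lip}_0(M)$ canonically; that is, there is a surjective linear isometry $I\colon \mathrm{lip}_0(M)^{**}\to\mathrm{Lip}_0(M)$ such that $I\circ\beta$ is the inclusion map $\mathrm{lip}_0(M)\hookrightarrow\mathrm{Lip}_0(M)$, where $\beta\colon\mathrm{lip}_0(M)\to\mathrm{lip}_0(M)^{**}$ is the canonical embedding into the bidual.
   Context: A pointed metric space is a metric space $(M,d)$ with a distinguished point $p\in M$. $\mathrm{Lip}_0(M)$ is the Banach space of all real-valued Lipschitz functions $F$ on $M$ with $F(p)=0$, normed by the Lipschitz constant $\|F\|_{\mathrm{Lip}}=\sup_{s\ne t}\frac{|F(s)-F(t)|}{d(s,t)}$. $\mathrm{lip}_0(M)$ is the closed subspace of those $f\in\mathrm{Lip}_0(M)$ with $\lim_{d(s,t)\to0}\frac{|f(s)-f(t)|}{d(s,t)}=0$ (i.e. for each $\varepsilon>0$ there is $\delta>0$ such that $|f(s)-f(t)|\le\varepsilon\, d(s,t)$ whenever $0<d(s,t)<\delta$). $B_Z$ denotes the closed unit ball of a Banach space $Z$. *)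

theory Defs
  imports "HOL-Analysis.Analysis"
begin

text \<open>
  A pointed metric space is modelled by a type, so that its Lipschitz spaces are types of class
  \<open>real_normed_vector\<close> and the library's \<open>\<Rightarrow>\<^sub>L\<close> yields their (bi)duals.
\<close>

class pointed_metric_space = metric_space +
  fixes base_point :: 'a

typedef (overloaded) 'a Lip0 =
    "{F :: 'a::pointed_metric_space \<Rightarrow> real. F base_point = 0 \<and> (\<exists>C. C-lipschitz_on UNIV F)}"
  morphisms Lip0_apply Abs_Lip0
  by (rule exI[of _ "\<lambda>_. 0"]) (auto intro!: exI[of _ 0] lipschitz_onI)

setup_lifting type_definition_Lip0

lemma Lip0_eqI: "(\<And>x. Lip0_apply F x = Lip0_apply G x) \<Longrightarrow> F = G"
  by (simp add: Lip0_apply_inject[symmetric] fun_eq_iff)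

text \<open>
  The supremum below also ranges over the pairs with \<open>s = t\<close>, where the quotient is \<open>0 / 0 = 0\<close>;
  this changes nothing except that the index set is non-empty when \<open>M\<close> is a single point.
\<close>

instantiation Lip0 :: (pointed_metric_space) real_normed_vector
begin

lift_definition norm_Lip0 :: "'a Lip0 \<Rightarrow> real"
  is "\<lambda>F. SUP (s, t). \<bar>F s - F t\<bar> / dist s t" .

lift_definition zero_Lip0 :: "'a Lip0" is "\<lambda>_. 0"
  by (auto intro!: exI[of _ 0] lipschitz_onI)

lift_definition plus_Lip0 :: "'a Lip0 \<Rightarrow> 'a Lip0 \<Rightarrow> 'a Lip0" is "\<lambda>F G x. F x + G x"
  by (auto intro: lipschitz_on_add)

lift_definition minus_Lip0 :: "'a Lip0 \<Rightarrow> 'a Lip0 \<Rightarrow> 'a Lip0" is "\<lambda>F G x. F x - G x"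
  by (auto intro: lipschitz_on_diff)

lift_definition uminus_Lip0 :: "'a Lip0 \<Rightarrow> 'a Lip0" is "\<lambda>F x. - F x"
  by (auto intro: lipschitz_on_minus)

lift_definition scaleR_Lip0 :: "real \<Rightarrow> 'a Lip0 \<Rightarrow> 'a Lip0" is "\<lambda>r F x. r * F x"
  by (auto intro: lipschitz_on_cmult_real)

definition sgn_Lip0 :: "'a Lip0 \<Rightarrow> 'a Lip0"
  where "sgn_Lip0 F = inverse (norm F) *\<^sub>R F"

definition dist_Lip0 :: "'a Lip0 \<Rightarrow> 'a Lip0 \<Rightarrow> real"
  where "dist_Lip0 F G = norm (F - G)"

definition uniformity_Lip0 :: "('a Lip0 \<times> 'a Lip0) filter"
  where "uniformity_Lip0 = (INF e\<in>{0<..}. principal {(F, G). dist F G < e})"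

definition open_Lip0 :: "'a Lip0 set \<Rightarrow> bool"
  where "open_Lip0 S \<longleftrightarrow> (\<forall>F\<in>S. \<forall>\<^sub>F (F', G) in uniformity. F' = F \<longrightarrow> G \<in> S)"

lemma Lip0_slopes_bdd_above:
  "bdd_above (range (\<lambda>(s, t). \<bar>Lip0_apply F s - Lip0_apply F t\<bar> / dist s t))"
proof -
  obtain C where C: "C-lipschitz_on UNIV (Lip0_apply F)"
    using Lip0_apply[of F] by auto
  have "\<bar>Lip0_apply F s - Lip0_apply F t\<bar> / dist s t \<le> C" for s t
    using lipschitz_onD[OF C, of s t] lipschitz_on_nonneg[OF C]
    by (cases "s = t") (simp_all add: dist_real_def divide_le_eq)
  then show ?thesis by (auto intro!: bdd_aboveI[of _ C])
qed

lemma Lip0_lipschitz: "\<bar>Lip0_apply F s - Lip0_apply F t\<bar> \<le> norm F * dist s t"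
proof (cases "s = t")
  case False
  have "\<bar>Lip0_apply F s - Lip0_apply F t\<bar> / dist s t \<le> norm F"
    unfolding norm_Lip0.rep_eq
    using cSUP_upper[OF UNIV_I Lip0_slopes_bdd_above[of F], of "(s, t)"] by simp
  with False show ?thesis by (simp add: divide_le_eq)
qed simp

lemma norm_Lip0_le:
  assumes "C \<ge> 0" "\<And>s t. \<bar>Lip0_apply F s - Lip0_apply F t\<bar> \<le> C * dist s t"
  shows "norm F \<le> C"
proof -
  have "\<bar>Lip0_apply F s - Lip0_apply F t\<bar> / dist s t \<le> C" for s t
    using assms by (cases "s = t") (simp_all add: divide_le_eq)
  then show ?thesis
    unfolding norm_Lip0.rep_eq by (intro cSUP_least) auto
qed

lemma norm_Lip0_nonneg: "0 \<le> norm (F :: 'a Lip0)"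
  unfolding norm_Lip0.rep_eq
  using cSUP_upper[OF UNIV_I Lip0_slopes_bdd_above[of F], of "(base_point, base_point)"] by simp

lemma norm_Lip0_scaleR_le: "norm (r *\<^sub>R F) \<le> \<bar>r\<bar> * norm (F :: 'a Lip0)"
proof (rule norm_Lip0_le)
  fix s t
  have "\<bar>Lip0_apply (r *\<^sub>R F) s - Lip0_apply (r *\<^sub>R F) t\<bar>
      = \<bar>r\<bar> * \<bar>Lip0_apply F s - Lip0_apply F t\<bar>"
    by (simp add: scaleR_Lip0.rep_eq abs_mult[symmetric] algebra_simps)
  then show "\<bar>Lip0_apply (r *\<^sub>R F) s - Lip0_apply (r *\<^sub>R F) t\<bar> \<le> \<bar>r\<bar> * norm F * dist s t"
    using mult_left_mono[OF Lip0_lipschitz[of F s t] abs_ge_zero[of r]] by (simp add: mult.assoc)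
qed (simp add: norm_Lip0_nonneg)

instance
proof
  fix F G H :: "'a Lip0" and r q :: real
  show "F + G + H = F + (G + H)" "F + G = G + F" "0 + F = F" "- F + F = 0" "F - G = F + - G"
    "r *\<^sub>R (F + G) = r *\<^sub>R F + r *\<^sub>R G" "(r + q) *\<^sub>R F = r *\<^sub>R F + q *\<^sub>R F"
    "r *\<^sub>R q *\<^sub>R F = (r * q) *\<^sub>R F" "1 *\<^sub>R F = F"
    by (rule Lip0_eqI; simp add: plus_Lip0.rep_eq zero_Lip0.rep_eq uminus_Lip0.rep_eq
        minus_Lip0.rep_eq scaleR_Lip0.rep_eq algebra_simps)+
  show "dist F G = norm (F - G)" by (fact dist_Lip0_def)
  show "sgn F = inverse (norm F) *\<^sub>R F" by (fact sgn_Lip0_def)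
  show "(uniformity :: ('a Lip0 \<times> 'a Lip0) filter) = (INF e\<in>{0<..}. principal {(F, G). dist F G < e})"
    by (fact uniformity_Lip0_def)
  show "open S \<longleftrightarrow> (\<forall>F\<in>S. \<forall>\<^sub>F (F', G) in uniformity. F' = F \<longrightarrow> G \<in> S)" for S :: "'a Lip0 set"
    by (fact open_Lip0_def)
  have base: "Lip0_apply F base_point = 0" for F :: "'a Lip0"
    using Lip0_apply[of F] by simp
  show "norm F = 0 \<longleftrightarrow> F = 0"
  proof
    assume "norm F = 0"
    then show "F = 0"
      using Lip0_lipschitz[of F _ base_point] by (intro Lip0_eqI) (simp add: base zero_Lip0.rep_eq)
  next
    assume "F = 0"
    then have "norm F \<le> 0" by (intro norm_Lip0_le) (simp_all add: zero_Lip0.rep_eq)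
    with norm_Lip0_nonneg[of F] show "norm F = 0" by simp
  qed
  show "norm (F + G) \<le> norm F + norm G"
  proof (rule norm_Lip0_le)
    show "\<bar>Lip0_apply (F + G) s - Lip0_apply (F + G) t\<bar> \<le> (norm F + norm G) * dist s t" for s t
      using Lip0_lipschitz[of F s t] Lip0_lipschitz[of G s t]
      by (simp add: plus_Lip0.rep_eq distrib_right)
  qed (simp add: norm_Lip0_nonneg)
  show "norm (r *\<^sub>R F) = \<bar>r\<bar> * norm F"
  proof (cases "r = 0")
    case True
    then show ?thesis
      using norm_Lip0_scaleR_le[of r F] norm_Lip0_nonneg[of "r *\<^sub>R F"] by simp
  next
    case False
    have "inverse r *\<^sub>R r *\<^sub>R F = F"
      using False by (intro Lip0_eqI) (simp add: scaleR_Lip0.rep_eq)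
    then have "norm F \<le> \<bar>inverse r\<bar> * norm (r *\<^sub>R F)"
      using norm_Lip0_scaleR_le[of "inverse r" "r *\<^sub>R F"] by simp
    then have "\<bar>r\<bar> * norm F \<le> norm (r *\<^sub>R F)"
      using False by (simp add: field_simps)
    with norm_Lip0_scaleR_le[of r F] show ?thesis by simp
  qed
qed

end

text \<open>
  The representation morphism \<open>lip0_incl\<close> of the following type is the inclusion map of
  \<open>lip\<^sub>0(M)\<close> into \<open>Lip\<^sub>0(M)\<close>.
\<close>

typedef (overloaded) 'a lip0 =
    "{f :: 'a::pointed_metric_space Lip0.
        \<forall>\<epsilon>>0. \<exists>\<delta>>0. \<forall>s t. 0 < dist s t \<and> dist s t < \<delta> \<longrightarrow>
          \<bar>Lip0_apply f s - Lip0_apply f t\<bar> \<le> \<epsilon> * dist s t}"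
  morphisms lip0_incl Abs_lip0
  by (rule exI[of _ 0]) (auto simp: zero_Lip0.rep_eq intro!: exI[of _ 1])

setup_lifting type_definition_lip0

instantiation lip0 :: (pointed_metric_space) real_normed_vector
begin

lift_definition norm_lip0 :: "'a lip0 \<Rightarrow> real" is norm .

lift_definition zero_lip0 :: "'a lip0" is 0
  by (auto simp: zero_Lip0.rep_eq intro!: exI[of _ 1])

lift_definition plus_lip0 :: "'a lip0 \<Rightarrow> 'a lip0 \<Rightarrow> 'a lip0" is "(+)"
proof -
  fix f g :: "'a Lip0" and \<epsilon> :: real
  assume small: "\<And>\<epsilon>. \<epsilon> > 0 \<Longrightarrow> \<exists>\<delta>>0. \<forall>s t. 0 < dist s t \<and> dist s t < \<delta> \<longrightarrow>
      \<bar>Lip0_apply f s - Lip0_apply f t\<bar> \<le> \<epsilon> * dist s t"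
    "\<And>\<epsilon>. \<epsilon> > 0 \<Longrightarrow> \<exists>\<delta>>0. \<forall>s t. 0 < dist s t \<and> dist s t < \<delta> \<longrightarrow>
      \<bar>Lip0_apply g s - Lip0_apply g t\<bar> \<le> \<epsilon> * dist s t"
    and "\<epsilon> > 0"
  from \<open>\<epsilon> > 0\<close> have "\<epsilon> / 2 > 0" by simp
  obtain \<delta>1 where \<delta>1: "\<delta>1 > 0" "\<And>s t. 0 < dist s t \<and> dist s t < \<delta>1 \<Longrightarrow>
      \<bar>Lip0_apply f s - Lip0_apply f t\<bar> \<le> \<epsilon> / 2 * dist s t"
    using small(1)[OF \<open>\<epsilon> / 2 > 0\<close>] by blast
  obtain \<delta>2 where \<delta>2: "\<delta>2 > 0" "\<And>s t. 0 < dist s t \<and> dist s t < \<delta>2 \<Longrightarrow>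
      \<bar>Lip0_apply g s - Lip0_apply g t\<bar> \<le> \<epsilon> / 2 * dist s t"
    using small(2)[OF \<open>\<epsilon> / 2 > 0\<close>] by blast
  have "\<bar>Lip0_apply (f + g) s - Lip0_apply (f + g) t\<bar> \<le> \<epsilon> * dist s t"
    if "0 < dist s t" "dist s t < min \<delta>1 \<delta>2" for s t
    using \<delta>1(2)[of s t] \<delta>2(2)[of s t] that unfolding plus_Lip0.rep_eq by linarith
  then show "\<exists>\<delta>>0. \<forall>s t. 0 < dist s t \<and> dist s t < \<delta> \<longrightarrow>
      \<bar>Lip0_apply (f + g) s - Lip0_apply (f + g) t\<bar> \<le> \<epsilon> * dist s t"
    using \<delta>1(1) \<delta>2(1) by (intro exI[of _ "min \<delta>1 \<delta>2"]) auto
qed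

lift_definition scaleR_lip0 :: "real \<Rightarrow> 'a lip0 \<Rightarrow> 'a lip0" is "(*\<^sub>R)"
proof -
  fix r :: real and f :: "'a Lip0" and \<epsilon> :: real
  assume small: "\<And>\<epsilon>. \<epsilon> > 0 \<Longrightarrow> \<exists>\<delta>>0. \<forall>s t. 0 < dist s t \<and> dist s t < \<delta> \<longrightarrow>
      \<bar>Lip0_apply f s - Lip0_apply f t\<bar> \<le> \<epsilon> * dist s t" and "\<epsilon> > 0"
  have "\<epsilon> / (\<bar>r\<bar> + 1) > 0" using \<open>\<epsilon> > 0\<close> by (simp add: add_nonneg_pos)
  then obtain \<delta> where \<delta>: "\<delta> > 0" "\<And>s t. 0 < dist s t \<and> dist s t < \<delta> \<Longrightarrow>
      \<bar>Lip0_apply f s - Lip0_apply f t\<bar> \<le> \<epsilon> / (\<bar>r\<bar> + 1) * dist s t"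
    using small by blast
  have "\<bar>Lip0_apply (r *\<^sub>R f) s - Lip0_apply (r *\<^sub>R f) t\<bar> \<le> \<epsilon> * dist s t"
    if "0 < dist s t" "dist s t < \<delta>" for s t
  proof -
    have "\<bar>Lip0_apply (r *\<^sub>R f) s - Lip0_apply (r *\<^sub>R f) t\<bar>
        = \<bar>r\<bar> * \<bar>Lip0_apply f s - Lip0_apply f t\<bar>"
      by (simp add: scaleR_Lip0.rep_eq abs_mult[symmetric] algebra_simps)
    also have "\<dots> \<le> (\<bar>r\<bar> + 1) * (\<epsilon> / (\<bar>r\<bar> + 1) * dist s t)"
      using \<delta>(2)[of s t] that by (intro mult_mono) auto
    also have "\<dots> = \<epsilon> * dist s t"
      by (simp add: add_nonneg_pos less_imp_neq[THEN not_sym])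
    finally show ?thesis .
  qed
  then show "\<exists>\<delta>>0. \<forall>s t. 0 < dist s t \<and> dist s t < \<delta> \<longrightarrow>
      \<bar>Lip0_apply (r *\<^sub>R f) s - Lip0_apply (r *\<^sub>R f) t\<bar> \<le> \<epsilon> * dist s t"
    using \<delta>(1) by blast
qed

definition uminus_lip0 :: "'a lip0 \<Rightarrow> 'a lip0"
  where "uminus_lip0 f = (-1) *\<^sub>R f"

definition minus_lip0 :: "'a lip0 \<Rightarrow> 'a lip0 \<Rightarrow> 'a lip0"
  where "minus_lip0 f g = f + - g"

definition sgn_lip0 :: "'a lip0 \<Rightarrow> 'a lip0"
  where "sgn_lip0 f = inverse (norm f) *\<^sub>R f"

definition dist_lip0 :: "'a lip0 \<Rightarrow> 'a lip0 \<Rightarrow> real"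
  where "dist_lip0 f g = norm (f - g)"

definition uniformity_lip0 :: "('a lip0 \<times> 'a lip0) filter"
  where "uniformity_lip0 = (INF e\<in>{0<..}. principal {(f, g). dist f g < e})"

definition open_lip0 :: "'a lip0 set \<Rightarrow> bool"
  where "open_lip0 S \<longleftrightarrow> (\<forall>f\<in>S. \<forall>\<^sub>F (f', g) in uniformity. f' = f \<longrightarrow> g \<in> S)"

instance
proof
  fix f g h :: "'a lip0" and r q :: real
  show "f + g + h = f + (g + h)" "f + g = g + f" "0 + f = f" "- f + f = 0"
    "r *\<^sub>R (f + g) = r *\<^sub>R f + r *\<^sub>R g" "(r + q) *\<^sub>R f = r *\<^sub>R f + q *\<^sub>R f"
    "r *\<^sub>R q *\<^sub>R f = (r * q) *\<^sub>R f" "1 *\<^sub>R f = f"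
    by (simp_all add: lip0_incl_inject[symmetric] plus_lip0.rep_eq zero_lip0.rep_eq uminus_lip0_def
        scaleR_lip0.rep_eq algebra_simps)
  show "f - g = f + - g" by (fact minus_lip0_def)
  show "dist f g = norm (f - g)" by (fact dist_lip0_def)
  show "sgn f = inverse (norm f) *\<^sub>R f" by (fact sgn_lip0_def)
  show "(uniformity :: ('a lip0 \<times> 'a lip0) filter) = (INF e\<in>{0<..}. principal {(f, g). dist f g < e})"
    by (fact uniformity_lip0_def)
  show "open S \<longleftrightarrow> (\<forall>f\<in>S. \<forall>\<^sub>F (f', g) in uniformity. f' = f \<longrightarrow> g \<in> S)" for S :: "'a lip0 set"
    by (fact open_lip0_def)
  show "norm f = 0 \<longleftrightarrow> f = 0"
    by (simp add: norm_lip0.rep_eq lip0_incl_inject[symmetric] zero_lip0.rep_eq)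
  show "norm (f + g) \<le> norm f + norm g"
    by (simp add: norm_lip0.rep_eq plus_lip0.rep_eq norm_triangle_ineq)
  show "norm (r *\<^sub>R f) = \<bar>r\<bar> * norm f"
    by (simp add: norm_lip0.rep_eq scaleR_lip0.rep_eq)
qed

end

definition pointwise_topology_on :: "'a::pointed_metric_space set \<Rightarrow> 'a Lip0 topology"
  where "pointwise_topology_on P =
    pullback_topology UNIV (\<lambda>F. restrict (Lip0_apply F) P) (product_topology (\<lambda>_. euclideanreal) P)"

lift_definition bidual_embedding :: "'z::real_normed_vector \<Rightarrow> (('z \<Rightarrow>\<^sub>L real) \<Rightarrow>\<^sub>L real)"
  is "\<lambda>z \<phi>. blinfun_apply \<phi> z"
  by (rule blinfun.bounded_linear_left)

end

theory Submission
  imports Defs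
begin

text \<open>
  Write \<open>\<delta>\<^sub>s\<close> for evaluation at \<open>s\<close>, an element of the dual of \<open>lip\<^sub>0(M)\<close>. The isometry sends \<open>\<Phi>\<close> in
  the bidual to the function \<open>s \<mapsto> \<Phi>(\<delta>\<^sub>s)\<close>. It is linear and does not increase norms, because
  \<open>\<parallel>\<delta>\<^sub>s - \<delta>\<^sub>t\<parallel> \<le> d(s,t)\<close>, and it extends the inclusion of \<open>lip\<^sub>0(M)\<close>. It remains to see that it
  is injective and that every \<open>F\<close> has a preimage of norm at most \<open>\<parallel>F\<parallel>\<close>.

  Both rest on \<open>point_eval_span_dense\<close>: the point evaluations span a norm-dense subspace of the dual.
  The analytic part is
  \<open>functional_sees_finitely_many_points\<close>: for each functional \<open>\<phi>\<close> and \<open>\<epsilon> > 0\<close> there is a finite set \<open>S\<close>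
  such that \<open>\<phi>\<close> has norm at most \<open>\<epsilon>\<close> on the functions that vanish on \<open>S\<close>. Otherwise there
  are functions in the unit ball, uniformly as small as desired, on which \<open>\<phi>\<close> exceeds \<open>\<epsilon>\<close>. A
  uniformly small function is steep only at small scales, and a little Lipschitz function is flat
  at small scales, so arbitrarily many such functions can be chosen one after another with a sum
  of norm at most \<open>2\<close>, and \<open>\<phi>\<close> would be unbounded. The algebraic part is
  \<open>near_span_of_functionals\<close>: a functional that is small on the common kernel of finitely many
  others is close to their span, by as many one-dimensional Hahn-Banach steps.

  Density of the span gives injectivity at once. For the preimage of \<open>F\<close> with \<open>\<parallel>F\<parallel> \<le> 1\<close>, the hypothesis
  on the unit balls and compactness yield \<open>f\<^sub>n\<close> in the unit ball of \<open>lip\<^sub>0(M)\<close> that converge to \<open>F\<close>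
  uniformly. By density, \<open>\<phi>(f\<^sub>n)\<close> converges for every \<open>\<phi>\<close>, and the limit is the required
  element of the bidual.
\<close>

section \<open>Approximating a functional by finitely many others\<close>

text \<open>
  This is the one-dimensional extension step of the Hahn-Banach theorem, in dual form. On the slice
  \<open>\<delta> x = 1\<close> the constant \<open>c\<close> has to lie above all \<open>\<phi> x - \<epsilon> \<parallel>x\<parallel>\<close> and below all \<open>\<phi> y + \<epsilon> \<parallel>y\<parallel>\<close>.
  There is such a \<open>c\<close> because \<open>x - y\<close> lies in the kernel of \<open>\<delta>\<close>; the rest is homogeneity.
\<close>

lemma one_functional_correction:
  fixes \<phi> \<delta> :: "'z::real_normed_vector \<Rightarrow>\<^sub>L real"
  assumes K: "subspace K" and \<epsilon>: "0 \<le> \<epsilon>"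
    and small: "\<And>x. x \<in> K \<Longrightarrow> \<delta> x = 0 \<Longrightarrow> \<bar>\<phi> x\<bar> \<le> \<epsilon> * norm x"
  shows "\<exists>c. \<forall>x\<in>K. \<bar>\<phi> x - c * \<delta> x\<bar> \<le> \<epsilon> * norm x"
proof (cases "\<exists>y\<in>K. \<delta> y = 1")
  case False
  have "\<delta> x = 0" if "x \<in> K" for x
  proof (rule ccontr)
    assume "\<delta> x \<noteq> 0"
    then have "\<delta> ((1 / \<delta> x) *\<^sub>R x) = 1"
      by (simp add: blinfun.scaleR_right)
    with False show False
      using subspace_scale[OF K that] by blast
  qed
  then show ?thesis
    using small by (intro exI[of _ 0]) simp
next
  case True
  then obtain y0 where y0: "y0 \<in> K" "\<delta> y0 = 1" by blast
  define A where "A = (\<lambda>x. \<phi> x - \<epsilon> * norm x) ` {x \<in> K. \<delta> x = 1}"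
  define c where "c = Sup A"
  have separated: "\<phi> x - \<epsilon> * norm x \<le> \<phi> y + \<epsilon> * norm y"
    if "x \<in> K" "\<delta> x = 1" "y \<in> K" "\<delta> y = 1" for x y
  proof -
    have "\<bar>\<phi> (x - y)\<bar> \<le> \<epsilon> * norm (x - y)"
      using that by (intro small) (simp_all add: subspace_diff[OF K] blinfun.diff_right)
    also have "\<dots> \<le> \<epsilon> * (norm x + norm y)"
      using \<epsilon> by (intro mult_left_mono norm_triangle_ineq4)
    finally show ?thesis
      by (simp add: blinfun.diff_right algebra_simps)
  qed
  have bdd: "bdd_above A"
    unfolding A_def using separated y0 by (intro bdd_aboveI2[of _ _ "\<phi> y0 + \<epsilon> * norm y0"]) auto
  have slice: "\<bar>\<phi> x - c\<bar> \<le> \<epsilon> * norm x" if x: "x \<in> K" "\<delta> x = 1" for x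
  proof -
    have "\<phi> x - \<epsilon> * norm x \<le> c"
      unfolding c_def by (rule cSup_upper[OF _ bdd]) (use x in \<open>auto simp: A_def\<close>)
    moreover have "c \<le> \<phi> x + \<epsilon> * norm x"
      unfolding c_def
      by (rule cSup_least) (use x y0 separated in \<open>auto simp: A_def\<close>)
    ultimately show ?thesis by linarith
  qed
  have "\<bar>\<phi> x - c * \<delta> x\<bar> \<le> \<epsilon> * norm x" if x: "x \<in> K" for x
  proof (cases "\<delta> x = 0")
    case True
    with small[OF x] show ?thesis by simp
  next
    case False
    have "\<bar>\<phi> ((1 / \<delta> x) *\<^sub>R x) - c\<bar> \<le> \<epsilon> * norm ((1 / \<delta> x) *\<^sub>R x)"
      using False by (intro slice) (simp_all add: subspace_scale[OF K x] blinfun.scaleR_right)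
    then have "\<bar>\<delta> x\<bar> * \<bar>\<phi> x / \<delta> x - c\<bar> \<le> \<bar>\<delta> x\<bar> * (\<epsilon> * (norm x / \<bar>\<delta> x\<bar>))"
      by (intro mult_left_mono) (simp_all add: blinfun.scaleR_right)
    also have "\<bar>\<delta> x\<bar> * \<bar>\<phi> x / \<delta> x - c\<bar> = \<bar>\<phi> x - c * \<delta> x\<bar>"
      using False by (simp add: abs_mult[symmetric] algebra_simps)
    finally show ?thesis
      using False by simp
  qed
  then show ?thesis by blast
qed

text \<open>
  Each correction removes one functional from those that define the kernel, without any loss
  in \<open>\<epsilon>\<close>.
\<close>

lemma near_span_of_functionals:
  fixes \<phi> :: "'z::real_normed_vector \<Rightarrow>\<^sub>L real" and \<delta> :: "'i \<Rightarrow> 'z \<Rightarrow>\<^sub>L real"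
  assumes "finite S" and \<epsilon>: "0 \<le> \<epsilon>"
    and "\<And>x. (\<And>s. s \<in> S \<Longrightarrow> \<delta> s x = 0) \<Longrightarrow> \<bar>\<phi> x\<bar> \<le> \<epsilon> * norm x"
  shows "\<exists>c. norm (\<phi> - (\<Sum>s\<in>S. c s *\<^sub>R \<delta> s)) \<le> \<epsilon>"
  using assms(1,3)
proof (induction S arbitrary: \<phi> rule: finite_induct)
  case empty
  then have "norm \<phi> \<le> \<epsilon>"
    using \<epsilon> by (intro norm_blinfun_bound) auto
  then show ?case by simp
next
  case (insert s S)
  define K where "K = {x. \<forall>s\<in>S. \<delta> s x = 0}"
  have "subspace K"
    by (auto simp: K_def subspace_def blinfun.add_right blinfun.scaleR_right)
  moreover have "\<bar>\<phi> x\<bar> \<le> \<epsilon> * norm x" if "x \<in> K" "\<delta> s x = 0" for x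
    using that by (intro insert.prems) (auto simp: K_def)
  ultimately obtain a where a: "\<forall>x\<in>K. \<bar>\<phi> x - a * \<delta> s x\<bar> \<le> \<epsilon> * norm x"
    using one_functional_correction[of K \<epsilon> "\<delta> s" \<phi>] \<epsilon> by blast
  have "\<bar>(\<phi> - a *\<^sub>R \<delta> s) x\<bar> \<le> \<epsilon> * norm x" if "\<And>s. s \<in> S \<Longrightarrow> \<delta> s x = 0" for x
    using a that by (simp add: K_def blinfun.diff_left blinfun.scaleR_left)
  from insert.IH[OF this]
  obtain c where c: "norm (\<phi> - a *\<^sub>R \<delta> s - (\<Sum>s\<in>S. c s *\<^sub>R \<delta> s)) \<le> \<epsilon>" by blast
  have "(\<Sum>r\<in>insert s S. (c(s := a)) r *\<^sub>R \<delta> r) = a *\<^sub>R \<delta> s + (\<Sum>r\<in>S. c r *\<^sub>R \<delta> r)"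
    using insert.hyps by simp (intro sum.cong, auto)
  with c show ?case
    by (intro exI[of _ "c(s := a)"]) (simp add: algebra_simps)
qed

section \<open>Point evaluations on the little Lipschitz space\<close>

abbreviation lip0_apply :: "'a::pointed_metric_space lip0 \<Rightarrow> 'a \<Rightarrow> real"
  where "lip0_apply f \<equiv> Lip0_apply (lip0_incl f)"

lemma Lip0_apply_base_point [simp]: "Lip0_apply F base_point = 0"
  using Lip0_apply[of F] by simp

lemma lip0_lipschitz: "\<bar>lip0_apply f s - lip0_apply f t\<bar> \<le> norm f * dist s t"
  using Lip0_lipschitz[of "lip0_incl f" s t] by (simp add: norm_lip0.rep_eq)

lemma norm_lip0_le:
  assumes "C \<ge> 0" "\<And>s t. \<bar>lip0_apply f s - lip0_apply f t\<bar> \<le> C * dist s t"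
  shows "norm f \<le> C"
  using norm_Lip0_le[of C "lip0_incl f"] assms by (simp add: norm_lip0.rep_eq)

lemma lip0_flat_at_small_scales:
  assumes "\<epsilon> > 0"
  obtains \<delta> where "\<delta> > 0"
    "\<And>s t. dist s t < \<delta> \<Longrightarrow> \<bar>lip0_apply f s - lip0_apply f t\<bar> \<le> \<epsilon> * dist s t"
proof -
  obtain \<delta> where \<delta>: "\<delta> > 0" "\<And>s t. 0 < dist s t \<Longrightarrow> dist s t < \<delta> \<Longrightarrow>
      \<bar>lip0_apply f s - lip0_apply f t\<bar> \<le> \<epsilon> * dist s t"
    using lip0_incl[of f] assms by blast
  have "\<bar>lip0_apply f s - lip0_apply f t\<bar> \<le> \<epsilon> * dist s t" if "dist s t < \<delta>" for s t
    using \<delta>(2)[of s t] that by (cases "s = t") auto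
  with \<delta>(1) that show thesis by blast
qed

lemma lip0_apply_add: "lip0_apply (f + g) x = lip0_apply f x + lip0_apply g x"
  by (simp add: plus_lip0.rep_eq plus_Lip0.rep_eq)

lemma lip0_apply_scaleR: "lip0_apply (r *\<^sub>R f) x = r * lip0_apply f x"
  by (simp add: scaleR_lip0.rep_eq scaleR_Lip0.rep_eq)

lift_definition point_eval :: "'a::pointed_metric_space \<Rightarrow> 'a lip0 \<Rightarrow>\<^sub>L real"
  is "\<lambda>s f. lip0_apply f s"
proof (rule bounded_linear_intro)
  fix s :: 'a and f g :: "'a lip0" and r :: real
  show "lip0_apply (f + g) s = lip0_apply f s + lip0_apply g s"
    by (rule lip0_apply_add)
  show "lip0_apply (r *\<^sub>R f) s = r *\<^sub>R lip0_apply f s"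
    by (simp add: lip0_apply_scaleR)
  show "norm (lip0_apply f s) \<le> norm f * dist s base_point"
    using lip0_lipschitz[of f s base_point] by simp
qed

lemma norm_point_eval_diff: "norm (point_eval s - point_eval t) \<le> dist s t"
  using lip0_lipschitz[of _ s t]
  by (intro norm_blinfun_bound)
     (simp_all add: blinfun.diff_left point_eval.rep_eq mult.commute)

section \<open>Density of the point evaluations in the dual\<close>

lemma compact_finite_net:
  assumes "compact (UNIV :: 'a::metric_space set)" and "closure P = (UNIV :: 'a set)" and "\<rho> > 0"
  shows "\<exists>S. finite S \<and> S \<subseteq> P \<and> (\<forall>x. \<exists>s\<in>S. dist x s < \<rho>)"
proof -
  have "UNIV \<subseteq> (\<Union>p\<in>P. ball p \<rho>)"
    using assms(2,3) closure_approachable[of _ P] by (auto simp: set_eq_iff)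
  then obtain S where S: "S \<subseteq> P" "finite S" "UNIV \<subseteq> (\<Union>p\<in>S. ball p \<rho>)"
    using compactE_image[OF assms(1), of P "\<lambda>p. ball p \<rho>"] by auto
  have "\<exists>s\<in>S. dist x s < \<rho>" for x
  proof -
    have "x \<in> (\<Union>p\<in>S. ball p \<rho>)" using S(3) by blast
    then show ?thesis by (auto simp: dist_commute)
  qed
  with S(1,2) show ?thesis by blast
qed

text \<open>
  A sliding hump argument: since the functions are flat at small scales, each new hump can be chosen
  to be steep only where the sum of the earlier ones is flat, and the slopes do not accumulate.
\<close>

lemma functional_sees_finitely_many_points:
  fixes \<phi> :: "'a::pointed_metric_space lip0 \<Rightarrow>\<^sub>L real"
  assumes "compact (UNIV :: 'a set)" and \<epsilon>: "\<epsilon> > 0"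
  shows "\<exists>S. finite S \<and> (\<forall>f. (\<forall>s\<in>S. lip0_apply f s = 0) \<longrightarrow> \<bar>\<phi> f\<bar> \<le> \<epsilon> * norm f)"
proof (rule ccontr)
  assume "\<not> ?thesis"
  then have bad: "\<exists>f. (\<forall>s\<in>S. lip0_apply f s = 0) \<and> \<bar>\<phi> f\<bar> > \<epsilon> * norm f" if "finite S" for S
    using that by (meson not_le)
  \<comment> \<open>A function in the unit ball that vanishes on a \<open>\<rho>\<close>-net is uniformly bounded by \<open>\<rho>\<close>.\<close>
  have hump: "\<exists>f. norm f \<le> 1 \<and> \<phi> f \<ge> \<epsilon> \<and> (\<forall>x. \<bar>lip0_apply f x\<bar> \<le> \<rho>)" if "\<rho> > 0" for \<rho>
  proof -
    obtain S :: "'a set" where S: "finite S" "\<And>x. \<exists>s\<in>S. dist x s < \<rho>"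
      using compact_finite_net[OF assms(1) closure_UNIV \<open>\<rho> > 0\<close>] by blast
    obtain h where h: "\<And>s. s \<in> S \<Longrightarrow> lip0_apply h s = 0" "\<bar>\<phi> h\<bar> > \<epsilon> * norm h"
      using bad[OF S(1)] by blast
    have pos: "norm h > 0"
      using h(2) by (cases "h = 0") auto
    define f where "f = (sgn (\<phi> h) / norm h) *\<^sub>R h"
    have "\<phi> f = \<bar>\<phi> h\<bar> / norm h"
      by (simp add: f_def blinfun.scaleR_right abs_sgn mult.commute)
    then have "\<phi> f \<ge> \<epsilon>"
      using h(2) pos by (simp add: pos_le_divide_eq)
    moreover have f1: "norm f \<le> 1"
      by (simp add: f_def abs_sgn_eq)
    moreover have "\<bar>lip0_apply f x\<bar> \<le> \<rho>" for x
    proof -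
      obtain s where s: "s \<in> S" "dist x s < \<rho>" using S(2) by blast
      have "\<bar>lip0_apply f x - lip0_apply f s\<bar> \<le> 1 * dist x s"
        using lip0_lipschitz[of f x s] f1 by (rule order_trans[OF _ mult_right_mono]) auto
      moreover have "lip0_apply f s = 0"
        using h(1)[OF s(1)] by (simp add: f_def lip0_apply_scaleR)
      ultimately show ?thesis using s(2) by simp
    qed
    ultimately show ?thesis by blast
  qed
  \<comment> \<open>Each new hump costs only \<open>\<eta>\<close> in norm: the sum so far has slope at most \<open>\<eta>\<close> at scales below
    some \<open>\<delta>\<close>, and a hump bounded by \<open>\<eta> \<delta> / 2\<close> has slope at most \<open>\<eta>\<close> at all other scales.\<close>
  have stack: "\<exists>g. norm g \<le> 1 + real n * \<eta> \<and> \<phi> g \<ge> real n * \<epsilon>" if \<eta>: "\<eta> > 0" for \<eta> :: real and n :: nat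
  proof (induction n)
    case 0
    show ?case by (intro exI[of _ 0]) simp
  next
    case (Suc n)
    then obtain g where g: "norm g \<le> 1 + real n * \<eta>" "\<phi> g \<ge> real n * \<epsilon>" by blast
    obtain \<delta> where \<delta>: "\<delta> > 0"
      "\<And>s t. dist s t < \<delta> \<Longrightarrow> \<bar>lip0_apply g s - lip0_apply g t\<bar> \<le> \<eta> * dist s t"
      using lip0_flat_at_small_scales[OF \<eta>] by blast
    obtain f where f: "norm f \<le> 1" "\<phi> f \<ge> \<epsilon>" "\<And>x. \<bar>lip0_apply f x\<bar> \<le> \<eta> * \<delta> / 2"
      using hump[of "\<eta> * \<delta> / 2"] \<eta> \<delta>(1) by auto
    have "norm (g + f) \<le> 1 + real (Suc n) * \<eta>"
    proof (rule norm_lip0_le)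
      fix s t
      have sum: "\<bar>lip0_apply (g + f) s - lip0_apply (g + f) t\<bar>
          \<le> \<bar>lip0_apply g s - lip0_apply g t\<bar> + \<bar>lip0_apply f s - lip0_apply f t\<bar>"
        by (simp add: lip0_apply_add)
      show "\<bar>lip0_apply (g + f) s - lip0_apply (g + f) t\<bar> \<le> (1 + real (Suc n) * \<eta>) * dist s t"
      proof (cases "dist s t < \<delta>")
        case True
        have "\<bar>lip0_apply f s - lip0_apply f t\<bar> \<le> 1 * dist s t"
          using lip0_lipschitz[of f s t] f(1) by (rule order_trans[OF _ mult_right_mono]) auto
        moreover have "0 \<le> real n * \<eta> * dist s t" using \<eta> by simp
        ultimately show ?thesis
          using sum \<delta>(2)[OF True] by (simp add: algebra_simps)
      next
        case False
        have "\<bar>lip0_apply f s - lip0_apply f t\<bar> \<le> \<eta> * \<delta>"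
          using f(3)[of s] f(3)[of t] by linarith
        also have "\<dots> \<le> \<eta> * dist s t"
          using False \<eta> by (intro mult_left_mono) auto
        finally have "\<bar>lip0_apply f s - lip0_apply f t\<bar> \<le> \<eta> * dist s t" .
        moreover have "\<bar>lip0_apply g s - lip0_apply g t\<bar> \<le> (1 + real n * \<eta>) * dist s t"
          using lip0_lipschitz[of g s t] g(1) by (rule order_trans[OF _ mult_right_mono]) auto
        ultimately show ?thesis
          using sum by (simp add: algebra_simps)
      qed
    qed (use \<eta> in simp)
    moreover have "\<phi> (g + f) \<ge> real (Suc n) * \<epsilon>"
      using g(2) f(2) by (simp add: blinfun.add_right algebra_simps)
    ultimately show ?case by blast
  qed
  \<comment> \<open>With \<open>\<eta> = 1 / n\<close> the sum of \<open>n\<close> humps has norm at most \<open>2\<close>.\<close>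
  obtain n :: nat where n: "real n * \<epsilon> > norm \<phi> * 2"
    using reals_Archimedean3[OF \<epsilon>] by blast
  then have "n > 0"
    using norm_ge_zero[of \<phi>] by (cases "n = 0") auto
  then obtain g where g: "norm g \<le> 1 + real n * (1 / real n)" "\<phi> g \<ge> real n * \<epsilon>"
    using stack[of "1 / real n" n] by auto
  have "\<phi> g \<le> norm \<phi> * norm g"
    using norm_blinfun[of \<phi> g] by simp
  also have "\<dots> \<le> norm \<phi> * 2"
    using g(1) \<open>n > 0\<close> by (intro mult_left_mono) auto
  finally show False
    using g(2) n by linarith
qed

lemma point_eval_span_dense:
  fixes \<phi> :: "'a::pointed_metric_space lip0 \<Rightarrow>\<^sub>L real"
  assumes "compact (UNIV :: 'a set)" and "\<epsilon> > 0"
  shows "\<exists>S c. finite S \<and> norm (\<phi> - (\<Sum>s\<in>S. c s *\<^sub>R point_eval s)) \<le> \<epsilon>"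
proof -
  obtain S where S: "finite S"
    "\<forall>f. (\<forall>s\<in>S. lip0_apply f s = 0) \<longrightarrow> \<bar>\<phi> f\<bar> \<le> \<epsilon> * norm f"
    using functional_sees_finitely_many_points[OF assms] by blast
  have "\<exists>c. norm (\<phi> - (\<Sum>s\<in>S. c s *\<^sub>R point_eval s)) \<le> \<epsilon>"
  proof (rule near_span_of_functionals[OF S(1)])
    show "\<bar>\<phi> f\<bar> \<le> \<epsilon> * norm f" if "\<And>s. s \<in> S \<Longrightarrow> point_eval s f = 0" for f
      using S(2) that by (simp add: point_eval.rep_eq)
  qed (use assms(2) in simp)
  with S(1) show ?thesis by blast
qed

section \<open>The canonical map from the bidual\<close>

lift_definition bidual_to_Lip0 ::
    "(('a::pointed_metric_space lip0 \<Rightarrow>\<^sub>L real) \<Rightarrow>\<^sub>L real) \<Rightarrow> 'a Lip0"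
  is "\<lambda>\<Phi> s. blinfun_apply \<Phi> (point_eval s)"
proof (intro conjI exI)
  fix \<Phi> :: "('a lip0 \<Rightarrow>\<^sub>L real) \<Rightarrow>\<^sub>L real"
  have "point_eval base_point = (0 :: 'a lip0 \<Rightarrow>\<^sub>L real)"
    by (rule blinfun_eqI) (simp add: point_eval.rep_eq)
  then show "\<Phi> (point_eval base_point) = 0" by simp
  show "(norm \<Phi>)-lipschitz_on UNIV (\<lambda>s. \<Phi> (point_eval s))"
  proof (rule lipschitz_onI)
    fix s t :: 'a
    have "dist (\<Phi> (point_eval s)) (\<Phi> (point_eval t)) \<le> norm \<Phi> * norm (point_eval s - point_eval t)"
      using norm_blinfun[of \<Phi> "point_eval s - point_eval t"]
      by (simp add: dist_norm blinfun.diff_right)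
    also have "\<dots> \<le> norm \<Phi> * dist s t"
      by (intro mult_left_mono norm_point_eval_diff) simp
    finally show "dist (\<Phi> (point_eval s)) (\<Phi> (point_eval t)) \<le> norm \<Phi> * dist s t" .
  qed simp
qed

lemma linear_bidual_to_Lip0: "linear bidual_to_Lip0"
  by (intro linearI Lip0_eqI)
     (simp_all add: bidual_to_Lip0.rep_eq plus_Lip0.rep_eq scaleR_Lip0.rep_eq
        blinfun.add_left blinfun.scaleR_left)

lemma norm_bidual_to_Lip0_le: "norm (bidual_to_Lip0 \<Phi>) \<le> norm \<Phi>"
proof (rule norm_Lip0_le)
  fix s t
  have "\<bar>\<Phi> (point_eval s - point_eval t)\<bar> \<le> norm \<Phi> * norm (point_eval s - point_eval t)"
    using norm_blinfun[of \<Phi> "point_eval s - point_eval t"] by simp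
  also have "\<dots> \<le> norm \<Phi> * dist s t"
    by (intro mult_left_mono norm_point_eval_diff) simp
  finally show "\<bar>Lip0_apply (bidual_to_Lip0 \<Phi>) s - Lip0_apply (bidual_to_Lip0 \<Phi>) t\<bar>
      \<le> norm \<Phi> * dist s t"
    by (simp add: bidual_to_Lip0.rep_eq blinfun.diff_right)
qed simp

lemma bidual_to_Lip0_embedding: "bidual_to_Lip0 (bidual_embedding f) = lip0_incl f"
  by (rule Lip0_eqI) (simp add: bidual_to_Lip0.rep_eq bidual_embedding.rep_eq point_eval.rep_eq)

lemma inj_bidual_to_Lip0:
  assumes "compact (UNIV :: 'a::pointed_metric_space set)"
  shows "inj (bidual_to_Lip0 :: (('a lip0 \<Rightarrow>\<^sub>L real) \<Rightarrow>\<^sub>L real) \<Rightarrow> 'a Lip0)"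
proof -
  have "\<Phi> = 0" if "bidual_to_Lip0 \<Phi> = 0" for \<Phi> :: "('a lip0 \<Rightarrow>\<^sub>L real) \<Rightarrow>\<^sub>L real"
  proof (rule blinfun_eqI)
    fix \<phi> :: "'a lip0 \<Rightarrow>\<^sub>L real"
    have evals: "\<Phi> (point_eval s) = 0" for s
      using that by (metis bidual_to_Lip0.rep_eq zero_Lip0.rep_eq)
    have "\<bar>\<Phi> \<phi>\<bar> \<le> norm \<Phi> * \<epsilon>" if "\<epsilon> > 0" for \<epsilon>
    proof -
      obtain S c where Sc: "finite S" "norm (\<phi> - (\<Sum>s\<in>S. c s *\<^sub>R point_eval s)) \<le> \<epsilon>"
        using point_eval_span_dense[OF assms \<open>\<epsilon> > 0\<close>] by blast
      have "\<Phi> \<phi> = \<Phi> (\<phi> - (\<Sum>s\<in>S. c s *\<^sub>R point_eval s))"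
        by (simp add: blinfun.diff_right blinfun.sum_right blinfun.scaleR_right evals)
      then have "\<bar>\<Phi> \<phi>\<bar> \<le> norm \<Phi> * norm (\<phi> - (\<Sum>s\<in>S. c s *\<^sub>R point_eval s))"
        using norm_blinfun[of \<Phi> "\<phi> - (\<Sum>s\<in>S. c s *\<^sub>R point_eval s)"] by simp
      also have "\<dots> \<le> norm \<Phi> * \<epsilon>"
        using Sc(2) by (intro mult_left_mono) auto
      finally show ?thesis .
    qed
    note bound = this
    have "\<bar>\<Phi> \<phi>\<bar> \<le> 0 + e" if "e > 0" for e
    proof -
      have "norm \<Phi> * e \<le> e * (norm \<Phi> + 1)"
        using that by (simp add: algebra_simps)
      then have "norm \<Phi> * (e / (norm \<Phi> + 1)) \<le> e"
        by (simp add: pos_divide_le_eq add_nonneg_pos)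
      then show ?thesis
        using bound[of "e / (norm \<Phi> + 1)"] that by (simp add: add_nonneg_pos)
    qed
    then have "\<bar>\<Phi> \<phi>\<bar> \<le> 0" by (rule field_le_epsilon)
    then show "\<Phi> \<phi> = blinfun_apply 0 \<phi>" by simp
  qed
  then show ?thesis
    using linear_injective_0[OF linear_bidual_to_Lip0] by blast
qed

section \<open>Lifting Lipschitz functions to the bidual\<close>

text \<open>
  Approximation at the points of a finite net in \<open>P\<close> is all that the pointwise topology provides.
  It suffices, since both functions have Lipschitz constant at most \<open>1\<close>.
\<close>

lemma uniform_approx_by_lip0_ball:
  fixes F :: "'a::pointed_metric_space Lip0"
  assumes comp: "compact (UNIV :: 'a set)" and dense: "closure P = UNIV"
    and ball: "cball (0 :: 'a Lip0) 1
           \<subseteq> pointwise_topology_on P closure_of (lip0_incl ` cball (0 :: 'a lip0) 1)"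
    and F: "norm F \<le> 1" and \<eta>: "\<eta> > 0"
  shows "\<exists>f. norm f \<le> 1 \<and> (\<forall>x. \<bar>lip0_apply f x - Lip0_apply F x\<bar> \<le> \<eta>)"
proof -
  \<comment> \<open>One third for the error at the net point, one third for the variation of each function.\<close>
  define \<rho> where "\<rho> = \<eta> / 3"
  have \<rho>: "\<rho> > 0" using \<eta> by (simp add: \<rho>_def)
  obtain S where S: "finite S" "S \<subseteq> P" "\<And>x. \<exists>s\<in>S. dist x s < \<rho>"
    using compact_finite_net[OF comp dense \<rho>] by blast
  define U where "U = PiE P (\<lambda>p. if p \<in> S then ball (Lip0_apply F p) \<rho> else UNIV)"
  define V where "V = (\<lambda>G. restrict (Lip0_apply G) P) -` U"
  have U: "openin (product_topology (\<lambda>_. euclideanreal) P) U"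
    unfolding U_def openin_PiE_gen
    by (intro disjI2 conjI ballI finite_subset[OF _ S(1)]) auto
  have "openin (pointwise_topology_on P) V"
    unfolding pointwise_topology_on_def openin_pullback_topology V_def using U by auto
  moreover have "F \<in> V"
    using \<rho> by (auto simp: V_def U_def)
  moreover have "F \<in> pointwise_topology_on P closure_of (lip0_incl ` cball (0 :: 'a lip0) 1)"
    using ball F by (auto simp: subset_iff)
  ultimately obtain G where G: "G \<in> lip0_incl ` cball (0 :: 'a lip0) 1" "G \<in> V"
    unfolding in_closure_of by blast
  then obtain f :: "'a lip0" where f: "norm f \<le> 1" "lip0_incl f \<in> V"
    by auto
  have near: "\<bar>lip0_apply f s - Lip0_apply F s\<bar> \<le> \<rho>" if "s \<in> S" for s
  proof -
    have "restrict (lip0_apply f) P s \<in> ball (Lip0_apply F s) \<rho>"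
      using f(2) S(2) that unfolding V_def U_def by (auto simp: PiE_iff split: if_splits)
    then show ?thesis
      using S(2) that by (auto simp: dist_real_def)
  qed
  have "\<bar>lip0_apply f x - Lip0_apply F x\<bar> \<le> \<eta>" for x
  proof -
    obtain s where s: "s \<in> S" "dist x s < \<rho>" using S(3) by blast
    have "\<bar>lip0_apply f x - lip0_apply f s\<bar> \<le> 1 * dist x s"
      using lip0_lipschitz[of f x s] f(1) by (rule order_trans[OF _ mult_right_mono]) auto
    moreover have "\<bar>Lip0_apply F x - Lip0_apply F s\<bar> \<le> 1 * dist x s"
      using Lip0_lipschitz[of F x s] F by (rule order_trans[OF _ mult_right_mono]) auto
    moreover have "\<eta> = 3 * \<rho>" by (simp add: \<rho>_def)
    ultimately show ?thesis
      using near[OF s(1)] s(2) unfolding abs_le_iff by linarith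
  qed
  with f(1) show ?thesis by blast
qed

text \<open>
  On linear combinations of point evaluations the convergence is the hypothesis. The bound on the
  norms transfers it to their norm closure, which is the whole dual.
\<close>

lemma Cauchy_functional_of_pointwise_convergent:
  fixes f :: "nat \<Rightarrow> 'a::pointed_metric_space lip0" and \<phi> :: "'a lip0 \<Rightarrow>\<^sub>L real"
  assumes comp: "compact (UNIV :: 'a set)"
    and bounded: "\<And>n. norm (f n) \<le> 1"
    and conv: "\<And>s. (\<lambda>n. lip0_apply (f n) s) \<longlonglongrightarrow> F s"
  shows "Cauchy (\<lambda>n. \<phi> (f n))"
proof (rule metric_CauchyI)
  fix e :: real
  assume e: "e > 0"
  obtain S c where Sc: "finite S" "norm (\<phi> - (\<Sum>s\<in>S. c s *\<^sub>R point_eval s)) \<le> e / 4"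
    using point_eval_span_dense[OF comp, of "e / 4"] e by (metis divide_pos_pos zero_less_numeral)
  define \<psi> where "\<psi> = (\<Sum>s\<in>S. c s *\<^sub>R point_eval s)"
  have "(\<lambda>n. \<psi> (f n)) \<longlonglongrightarrow> (\<Sum>s\<in>S. c s * F s)"
    unfolding \<psi>_def
    by (simp add: blinfun.sum_left blinfun.scaleR_left point_eval.rep_eq)
       (intro tendsto_intros conv)
  then have "Cauchy (\<lambda>n. \<psi> (f n))" by (rule LIMSEQ_imp_Cauchy)
  then obtain N where N: "\<And>m n. m \<ge> N \<Longrightarrow> n \<ge> N \<Longrightarrow> dist (\<psi> (f m)) (\<psi> (f n)) < e / 2"
    using e unfolding Cauchy_def by (metis half_gt_zero)
  have close: "\<bar>\<phi> (f n) - \<psi> (f n)\<bar> \<le> e / 4" for n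
  proof -
    have "\<bar>(\<phi> - \<psi>) (f n)\<bar> \<le> norm (\<phi> - \<psi>) * norm (f n)"
      using norm_blinfun[of "\<phi> - \<psi>" "f n"] by simp
    also have "\<dots> \<le> e / 4 * 1"
      using Sc(2) bounded e by (intro mult_mono) (auto simp: \<psi>_def)
    finally show ?thesis by (simp add: blinfun.diff_left)
  qed
  have "dist (\<phi> (f m)) (\<phi> (f n)) < e" if "m \<ge> N" "n \<ge> N" for m n
    using N[OF that] close[of m] close[of n] unfolding dist_real_def by linarith
  then show "\<exists>N. \<forall>m\<ge>N. \<forall>n\<ge>N. dist (\<phi> (f m)) (\<phi> (f n)) < e" by blast
qed

text \<open>
  The preimage is the weak-star limit in the bidual of a sequence from the unit ball of
  \<open>lip\<^sub>0(M)\<close>; the limit inherits the bound \<open>1\<close> on the norm.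
\<close>

lemma bidual_to_Lip0_onto_ball:
  fixes F :: "'a::pointed_metric_space Lip0"
  assumes comp: "compact (UNIV :: 'a set)" and dense: "closure P = UNIV"
    and ball: "cball (0 :: 'a Lip0) 1
           \<subseteq> pointwise_topology_on P closure_of (lip0_incl ` cball (0 :: 'a lip0) 1)"
    and F: "norm F \<le> 1"
  shows "\<exists>\<Phi>. bidual_to_Lip0 \<Phi> = F \<and> norm \<Phi> \<le> 1"
proof -
  have "\<exists>f. norm f \<le> 1 \<and> (\<forall>x. \<bar>lip0_apply f x - Lip0_apply F x\<bar> \<le> 1 / real (Suc n))" for n
    using uniform_approx_by_lip0_ball[OF comp dense ball F, of "1 / real (Suc n)"] by simp
  then have "\<exists>f. \<forall>n. norm (f n) \<le> 1 \<and>
      (\<forall>x. \<bar>lip0_apply (f n) x - Lip0_apply F x\<bar> \<le> 1 / real (Suc n))"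
    by (rule choice[OF allI])
  then obtain f where f: "\<And>n. norm (f n) \<le> 1"
    "\<And>n x. \<bar>lip0_apply (f n) x - Lip0_apply F x\<bar> \<le> 1 / real (Suc n)"
    by blast
  have conv: "(\<lambda>n. lip0_apply (f n) s) \<longlonglongrightarrow> Lip0_apply F s" for s
  proof (rule LIM_zero_cancel, rule Lim_null_comparison)
    show "(\<lambda>n. 1 / real (Suc n)) \<longlonglongrightarrow> 0"
      using LIMSEQ_inverse_real_of_nat by (simp add: inverse_eq_divide)
    show "\<forall>\<^sub>F n in sequentially. norm (lip0_apply (f n) s - Lip0_apply F s) \<le> 1 / real (Suc n)"
      using f(2) by simp
  qed
  define L where "L \<phi> = lim (\<lambda>n. blinfun_apply \<phi> (f n))" for \<phi> :: "'a lip0 \<Rightarrow>\<^sub>L real"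
  have L: "(\<lambda>n. \<phi> (f n)) \<longlonglongrightarrow> L \<phi>" for \<phi> :: "'a lip0 \<Rightarrow>\<^sub>L real"
    unfolding L_def
    using Cauchy_functional_of_pointwise_convergent[OF comp f(1) conv, of \<phi>]
    by (simp add: Cauchy_convergent_iff convergent_LIMSEQ_iff)
  have L_le: "norm (L \<phi>) \<le> norm \<phi> * 1" for \<phi>
  proof (rule LIMSEQ_le_const2[OF tendsto_norm[OF L]], intro exI allI impI)
    fix n
    have "norm (\<phi> (f n)) \<le> norm \<phi> * norm (f n)" by (rule norm_blinfun)
    also have "\<dots> \<le> norm \<phi> * 1" by (intro mult_left_mono f(1)) simp
    finally show "norm (\<phi> (f n)) \<le> norm \<phi> * 1" .
  qed
  have blin: "bounded_linear L"
  proof (rule bounded_linear_intro[OF _ _ L_le])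
    fix \<phi> \<psi> :: "'a lip0 \<Rightarrow>\<^sub>L real" and r :: real
    show "L (\<phi> + \<psi>) = L \<phi> + L \<psi>"
      using L[of "\<phi> + \<psi>"] tendsto_add[OF L[of \<phi>] L[of \<psi>]]
      by (intro LIMSEQ_unique) (simp_all add: blinfun.add_left)
    show "L (r *\<^sub>R \<phi>) = r *\<^sub>R L \<phi>"
      using L[of "r *\<^sub>R \<phi>"] tendsto_scaleR[OF tendsto_const L[of \<phi>], of r]
      by (intro LIMSEQ_unique) (simp_all add: blinfun.scaleR_left)
  qed
  have L_apply: "blinfun_apply (Blinfun L) = L"
    using blin by (rule bounded_linear_Blinfun_apply)
  have "bidual_to_Lip0 (Blinfun L) = F"
  proof (rule Lip0_eqI)
    fix s
    have "L (point_eval s) = Lip0_apply F s"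
      using L[of "point_eval s"] conv[of s] by (simp add: point_eval.rep_eq LIMSEQ_unique)
    then show "Lip0_apply (bidual_to_Lip0 (Blinfun L)) s = Lip0_apply F s"
      by (simp add: bidual_to_Lip0.rep_eq L_apply)
  qed
  moreover have "norm (Blinfun L) \<le> 1"
    using L_le by (intro norm_blinfun_bound) (auto simp: L_apply)
  ultimately show ?thesis by blast
qed

theorem theorem4p2:
  fixes P :: "'a::pointed_metric_space set"
  assumes "compact (UNIV :: 'a set)"
    and "countable P" and "closure P = UNIV"
    and "cball (0 :: 'a Lip0) 1
           \<subseteq> pointwise_topology_on P closure_of (lip0_incl ` cball (0 :: 'a lip0) 1)"
  shows "\<exists>I :: (('a lip0 \<Rightarrow>\<^sub>L real) \<Rightarrow>\<^sub>L real) \<Rightarrow> 'a Lip0.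
           linear I \<and> surj I \<and> (\<forall>\<Phi>. norm (I \<Phi>) = norm \<Phi>) \<and>
           I \<circ> bidual_embedding = lip0_incl"
proof (intro exI conjI allI)
  let ?I = "bidual_to_Lip0 :: (('a lip0 \<Rightarrow>\<^sub>L real) \<Rightarrow>\<^sub>L real) \<Rightarrow> 'a Lip0"
  have lift: "\<exists>\<Phi>. ?I \<Phi> = F \<and> norm \<Phi> \<le> norm F" for F
  proof (cases "F = 0")
    case True
    then show ?thesis
      using linear_0[OF linear_bidual_to_Lip0] by (intro exI[of _ 0]) simp
  next
    case False
    then obtain \<Psi> where \<Psi>: "?I \<Psi> = (1 / norm F) *\<^sub>R F" "norm \<Psi> \<le> 1"
      using bidual_to_Lip0_onto_ball[OF assms(1,3,4), of "(1 / norm F) *\<^sub>R F"] by auto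
    have "norm (norm F *\<^sub>R \<Psi>) \<le> norm F"
      using mult_left_mono[OF \<Psi>(2), of "norm F"] by simp
    moreover have "?I (norm F *\<^sub>R \<Psi>) = F"
      using \<Psi>(1) False by (simp add: linear_scale[OF linear_bidual_to_Lip0])
    ultimately show ?thesis by blast
  qed
  show "linear ?I" by (rule linear_bidual_to_Lip0)
  show "surj ?I" using lift by (metis surjI)
  show "?I \<circ> bidual_embedding = lip0_incl"
    by (simp add: fun_eq_iff bidual_to_Lip0_embedding)
  \<comment> \<open>By injectivity, \<open>\<Phi>\<close> is itself the preimage of controlled norm.\<close>
  show "norm (?I \<Phi>) = norm \<Phi>" for \<Phi>
  proof (rule antisym[OF norm_bidual_to_Lip0_le])
    obtain \<Psi> where \<Psi>: "?I \<Psi> = ?I \<Phi>" "norm \<Psi> \<le> norm (?I \<Phi>)"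
      using lift by blast
    from injD[OF inj_bidual_to_Lip0[OF assms(1)] \<Psi>(1)] \<Psi>(2)
    show "norm \<Phi> \<le> norm (?I \<Phi>)" by simp
  qed
qed

end
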